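(* Let $n\ge 2$, let $k_1,k_2>0$, and consider $n$ agents $\ddot x_i(t)=u_i(t)$, $i=1,\dots,n$, communicating over a connected undirected graph with Laplacian matrix $\mathbf L$, under the consensus protocol with self-delay $$u_i(t)=k_1\sum_{j\in\mathcal N_i}\bigl(x_j(t-\tau)-x_i(t-\tau)\bigr)+k_2\sum_{j\in\mathcal N_i}\bigl(\dot x_j(t-\tau)-\dot x_i(t-\tau)\bigr).$$ Then the most exigent eigenvalue for this protocol is the largest eigenvalue of $\mathbf L$. That is, for fixed $k_1,k_2$, among the factors $$q_i(s,k_1,k_2,\tau,\lambda_i)=s^2+\lambda_i(k_2 s+k_1)e^{-\tau s}$$ generated by the eigenvalues $\lambda_i$ of $\mathbf L$, the factor whose first destabilizing crossing occurs at the smallest delay, as $\tau$ increases from $0$, is the one generated by the largest eigenvalue of $\mathbf L$.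
   Context: The communication graph is undirected and simple. $\mathcal N_i$ is the set of neighbours (informers) of agent $i$, $\delta_i=|\mathcal N_i|$, $\mathbf A_\Gamma$ is the $0/1$ adjacency matrix with zero diagonal, $\boldsymbol\Delta=\mathrm{diag}(\delta_1,\dots,\delta_n)$, and $\mathbf L=\boldsymbol\Delta-\mathbf A_\Gamma$. The delay $\tau\ge 0$ is constant and uniform. With $\mathbf x=[x_1\,\dot x_1\cdots x_n\,\dot x_n]^T$ the closed loop is $\dot{\mathbf x}(t)=(\mathbf I_n\otimes\mathbf F_1)\mathbf x(t)+(\mathbf M\otimes\mathbf F_2)\mathbf x(t-\tau)$, where $\mathbf F_1=\begin{bmatrix}0&1\\0&0\end{bmatrix}$, $\mathbf F_2=\begin{bmatrix}0&0\\k_1&k_2\end{bmatrix}$ and $\mathbf M=-\mathbf L$. Its characteristic equation is $\prod_{i=1}^n q_i=0$, where $q_i$ is the determinant $\det(s\mathbf I_2-\mathbf F_1+\lambda_i\mathbf F_2e^{-\tau s})$ and $\lambda_1,\dots,\lambda_n\ge 0$ are the eigenvalues of $\mathbf L$ (the sign is changed so as to use the eigenvalues of $\mathbf L$ rather than those of $\mathbf M=-\mathbf L$). The eigenvalue $\lambda_1=0$ is simple by connectivity and gives the delay-independent centroid factor $s^2$, which has no destabilizing crossing; the factors with $\lambda_i>0$ are stable for $\tau=0$. A destabilizing crossing of a factor is a value $\tau>0$ at which, as $\tau$ increases, a root of the factor crosses the imaginary axis from the left half-plane into the right half-plane. The most exigent eigenvalue is the eigenvalue that generates the factor of the characteristic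 equation which introduces the smallest (in $\tau$) destabilizing crossing as $\tau$ increases starting from $0$, for a fixed pair $k_1,k_2$. *)

theory Defs
  imports Complex_Main "Jordan_Normal_Form.Spectral_Radius" "Graph_Theory.Graph_Theory"
begin

text \<open>The communication graph is a \<open>pair_graph\<close> (finite, symmetric, without loops) whose
  vertices, the agents, are \<open>{0..<n}\<close>; an undirected edge is a pair of opposite arcs.\<close>

definition neighbours :: "nat pair_pre_digraph \<Rightarrow> nat \<Rightarrow> nat set" where
  "neighbours G i = {j. (i, j) \<in> parcs G}"

definition adjacency_mat :: "nat \<Rightarrow> nat pair_pre_digraph \<Rightarrow> real mat" where
  "adjacency_mat n G = mat n n (\<lambda>(i, j). if (i, j) \<in> parcs G then 1 else 0)"

definition degree_mat :: "nat \<Rightarrow> nat pair_pre_digraph \<Rightarrow> real mat" where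
  "degree_mat n G = mat n n (\<lambda>(i, j). if i = j then real (card (neighbours G i)) else 0)"

definition laplacian :: "nat \<Rightarrow> nat pair_pre_digraph \<Rightarrow> real mat" where
  "laplacian n G = degree_mat n G - adjacency_mat n G"

text \<open>Positions \<open>x i t\<close> and velocities \<open>v i t\<close> of the agents, including the history on
  \<open>[-\<tau>, 0]\<close>; derivatives at the left end of an interval are one-sided.\<close>

definition velocities_of ::
    "nat \<Rightarrow> real \<Rightarrow> (nat \<Rightarrow> real \<Rightarrow> real) \<Rightarrow> (nat \<Rightarrow> real \<Rightarrow> real) \<Rightarrow> bool" where
  "velocities_of n \<tau> x v \<longleftrightarrow>
     (\<forall>i<n. \<forall>t\<ge>-\<tau>. (x i has_real_derivative v i t) (at t within {-\<tau>..}))"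

definition protocol ::
    "nat pair_pre_digraph \<Rightarrow> real \<Rightarrow> real \<Rightarrow> real \<Rightarrow>
     (nat \<Rightarrow> real \<Rightarrow> real) \<Rightarrow> (nat \<Rightarrow> real \<Rightarrow> real) \<Rightarrow> nat \<Rightarrow> real \<Rightarrow> real" where
  "protocol G k1 k2 \<tau> x v i t =
     k1 * (\<Sum>j\<in>neighbours G i. x j (t - \<tau>) - x i (t - \<tau>)) +
     k2 * (\<Sum>j\<in>neighbours G i. v j (t - \<tau>) - v i (t - \<tau>))"

definition follows_protocol ::
    "nat \<Rightarrow> nat pair_pre_digraph \<Rightarrow> real \<Rightarrow> real \<Rightarrow> real \<Rightarrow>
     (nat \<Rightarrow> real \<Rightarrow> real) \<Rightarrow> (nat \<Rightarrow> real \<Rightarrow> real) \<Rightarrow> bool" where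
  "follows_protocol n G k1 k2 \<tau> x v \<longleftrightarrow>
     (\<forall>i<n. \<forall>t\<ge>0. (v i has_real_derivative protocol G k1 k2 \<tau> x v i t) (at t within {0..}))"

definition kronecker :: "'a::times mat \<Rightarrow> 'a mat \<Rightarrow> 'a mat" where
  "kronecker A B = mat (dim_row A * dim_row B) (dim_col A * dim_col B)
     (\<lambda>(r, c). A $$ (r div dim_row B, c div dim_col B) * B $$ (r mod dim_row B, c mod dim_col B))"

definition F1 :: "real mat" where
  "F1 = mat_of_rows_list 2 [[0, 1], [0, 0]]"

definition F2 :: "real \<Rightarrow> real \<Rightarrow> real mat" where
  "F2 k1 k2 = mat_of_rows_list 2 [[0, 0], [k1, k2]]"

definition state :: "nat \<Rightarrow> (nat \<Rightarrow> real \<Rightarrow> real) \<Rightarrow> (nat \<Rightarrow> real \<Rightarrow> real) \<Rightarrow> real \<Rightarrow> real vec" where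
  "state n x v t = vec (2 * n) (\<lambda>r. if even r then x (r div 2) t else v (r div 2) t)"

definition closed_loop ::
    "nat \<Rightarrow> nat pair_pre_digraph \<Rightarrow> real \<Rightarrow> real \<Rightarrow> real \<Rightarrow> (real \<Rightarrow> real vec) \<Rightarrow> bool" where
  "closed_loop n G k1 k2 \<tau> X \<longleftrightarrow>
     (\<forall>r<2 * n. \<forall>t\<ge>0.
        ((\<lambda>t. X t $ r) has_real_derivative
           (kronecker (1\<^sub>m n) F1 *\<^sub>v X t
            + kronecker (- laplacian n G) (F2 k1 k2) *\<^sub>v X (t - \<tau>)) $ r) (at t within {0..}))"

definition characteristic_fun ::
    "nat \<Rightarrow> nat pair_pre_digraph \<Rightarrow> real \<Rightarrow> real \<Rightarrow> real \<Rightarrow> complex \<Rightarrow> complex" where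
  "characteristic_fun n G k1 k2 \<tau> s =
     det (s \<cdot>\<^sub>m 1\<^sub>m (2 * n)
          - map_mat complex_of_real (kronecker (1\<^sub>m n) F1)
          - exp (- complex_of_real \<tau> * s) \<cdot>\<^sub>m
              map_mat complex_of_real (kronecker (- laplacian n G) (F2 k1 k2)))"

definition char_factor :: "real \<Rightarrow> real \<Rightarrow> real \<Rightarrow> real \<Rightarrow> complex \<Rightarrow> complex" where
  "char_factor k1 k2 l \<tau> s =
     det (s \<cdot>\<^sub>m 1\<^sub>m 2
          - map_mat complex_of_real F1
          + (complex_of_real l * exp (- complex_of_real \<tau> * s)) \<cdot>\<^sub>m
              map_mat complex_of_real (F2 k1 k2))"

text \<open>A family \<open>q\<close> of functions of \<open>s\<close>, depending on the delay, has a destabilizing crossing at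
  \<open>\<tau>\<close> if some continuous branch \<open>r\<close> of roots, defined for delays near \<open>\<tau>\<close>, passes from the open
  left half-plane to the open right half-plane exactly at \<open>\<tau>\<close>. The radius \<open>e \<le> \<tau>\<close> keeps all
  delays involved positive.\<close>

definition destabilizing_crossing :: "(real \<Rightarrow> complex \<Rightarrow> complex) \<Rightarrow> real \<Rightarrow> bool" where
  "destabilizing_crossing q \<tau> \<longleftrightarrow> \<tau> > 0 \<and>
     (\<exists>e r. 0 < e \<and> e \<le> \<tau> \<and>
        continuous_on {\<tau> - e<..<\<tau> + e} r \<and>
        (\<forall>t\<in>{\<tau> - e<..<\<tau> + e}. q t (r t) = 0) \<and>
        (\<forall>t\<in>{\<tau> - e<..<\<tau>}. Re (r t) < 0) \<and>
        Re (r \<tau>) = 0 \<and>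
        (\<forall>t\<in>{\<tau><..<\<tau> + e}. Re (r t) > 0))"

definition most_exigent :: "nat \<Rightarrow> nat pair_pre_digraph \<Rightarrow> real \<Rightarrow> real \<Rightarrow> real \<Rightarrow> bool" where
  "most_exigent n G k1 k2 l \<longleftrightarrow> l \<in> spectrum (laplacian n G) \<and>
     (\<exists>\<tau>. destabilizing_crossing (char_factor k1 k2 l) \<tau> \<and>
        (\<forall>l'\<in>spectrum (laplacian n G). \<forall>\<tau>'.
           destabilizing_crossing (char_factor k1 k2 l') \<tau>' \<longrightarrow> \<tau> \<le> \<tau>'))"

end

theory Submission
  imports "HOL-Complex_Analysis.Conformal_Mappings" Defs
begin

text \<open>If the factor of \<open>l > 0\<close> has a root \<open>\<i> y\<close>, then comparing moduli shows that
  \<open>w = \<bar>y\<bar>\<close> is the unique positive solution of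
  \<open>w\<^sup>4 = l\<^sup>2 (k1\<^sup>2 + k2\<^sup>2 w\<^sup>2)\<close>, and comparing
  arguments that the delay is at least \<open>arctan (k2 w / k1) / w\<close>. At that delay the root does
  cross, from left to right. Since \<open>w\<close> increases with \<open>l\<close> and \<open>arctan x / x\<close> decreases, the first
  crossing comes earliest for the largest eigenvalue. The Laplacian being symmetric and positive
  semidefinite with positive trace, its spectrum is real and nonnegative and the largest eigenvalue
  is positive.\<close>

unbundle no vec_syntax

section \<open>Determinants, traces and the Laplacian spectrum\<close>

text \<open>Collecting equal entries works because each \<open>a\<close> occurs in \<open>as\<close>
  exactly \<open>order a p\<close> times. This is what turns a list of eigenvalues into the spectrum
  with algebraic multiplicities.\<close>

lemma prod_list_map_eq_prod_power_order:
  fixes f :: "'a::field \<Rightarrow> 'b::comm_monoid_mult"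
  assumes p: "p = (\<Prod>a\<leftarrow>as. [:- a, 1:])"
  shows "(\<Prod>a\<leftarrow>as. f a) = (\<Prod>a\<in>{x. poly p x = 0}. f a ^ order a p)"
proof -
  have "order x (\<Prod>a\<leftarrow>as. [:- a, 1:]) = count_list as x" for x
  proof -
    have "order x [:- a, 1:] = (if a = x then 1 else 0)" for a
      using order_power_n_n[of x 1] order_root[of "[:- a, 1:]" x] by auto
    moreover have "order x (\<Prod>a\<leftarrow>as. [:- a, 1:]) = (\<Sum>q\<leftarrow>map (\<lambda>a. [:- a, 1:]) as. order x q)"
      by (rule order_prod_list) auto
    moreover have "(\<Sum>a\<leftarrow>as. if a = x then 1 else 0) = count_list as x"
      by (induction as) auto
    ultimately show ?thesis
      by (simp add: o_def)
  qed
  moreover have "{x. poly p x = 0} = set as"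
    by (auto simp: p poly_prod_list prod_list_zero_iff)
  moreover have "(\<Prod>a\<leftarrow>as. f a) = (\<Prod>a\<in>set as. f a ^ count_list as a)"
  proof (induction as)
    case (Cons b as)
    show ?case
    proof (cases "b \<in> set as")
      case True
      then have "(\<Prod>a\<in>set as. f a ^ count_list (b # as) a)
          = f b ^ count_list (b # as) b * (\<Prod>a\<in>set as - {b}. f a ^ count_list (b # as) a)"
        by (intro prod.remove) auto
      also have "\<dots> = f b * (f b ^ count_list as b * (\<Prod>a\<in>set as - {b}. f a ^ count_list as a))"
      proof -
        have "(\<Prod>a\<in>set as - {b}. f a ^ count_list (b # as) a)
            = (\<Prod>a\<in>set as - {b}. f a ^ count_list as a)"
          by (intro prod.cong) auto
        then show ?thesis by (simp add: mult.assoc)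
      qed
      also have "f b ^ count_list as b * (\<Prod>a\<in>set as - {b}. f a ^ count_list as a)
          = (\<Prod>a\<in>set as. f a ^ count_list as a)"
        using True by (intro prod.remove[symmetric]) auto
      finally show ?thesis using Cons True by (simp add: insert_absorb)
    next
      case False
      then have "(\<Prod>a\<in>set as. f a ^ count_list (b # as) a) = (\<Prod>a\<in>set as. f a ^ count_list as a)"
        by (intro prod.cong) auto
      with False Cons show ?thesis by simp
    qed
  qed simp
  ultimately show ?thesis by (simp add: p)
qed

text \<open>For \<open>c \<noteq> 0\<close> the matrix is \<open>- c\<close> times
  \<open>(- x / c) I - A\<close>, so its determinant is \<open>(- c) ^ n\<close> times the
  characteristic polynomial at \<open>- x / c\<close>. As \<open>as\<close> has length
  \<open>n\<close>, each linear factor absorbs one \<open>- c\<close>.\<close>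

lemma det_smult_one_add_smult:
  fixes A :: "'a::field mat"
  assumes A: "A \<in> carrier_mat n n" and as: "char_poly A = (\<Prod>a\<leftarrow>as. [:- a, 1:])"
  shows "det (x \<cdot>\<^sub>m 1\<^sub>m n + c \<cdot>\<^sub>m A) = (\<Prod>a\<leftarrow>as. x + c * a)"
proof -
  have len: "length as = n"
    using degree_monic_char_poly[OF A] degree_linear_factors[of uminus as] as by simp
  show ?thesis
  proof (cases "c = 0")
    case True
    then have "x \<cdot>\<^sub>m 1\<^sub>m n + c \<cdot>\<^sub>m A = x \<cdot>\<^sub>m 1\<^sub>m n"
      using A by (intro eq_matI) auto
    then show ?thesis
      using True len by (simp add: prod_list_replicate map_replicate_const)
  next
    case False
    have "x \<cdot>\<^sub>m 1\<^sub>m n + c \<cdot>\<^sub>m A = (- c) \<cdot>\<^sub>m (- char_matrix A (- x / c))"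
      using A False by (intro eq_matI) (auto simp: char_matrix_def field_simps)
    then have "det (x \<cdot>\<^sub>m 1\<^sub>m n + c \<cdot>\<^sub>m A) = (- c) ^ n * det (- char_matrix A (- x / c))"
      using A by (simp add: char_matrix_def)
    also have "\<dots> = (- c) ^ n * poly (char_poly A) (- x / c)"
      by (simp only: char_poly_matrix[OF A])
    also have "\<dots> = (\<Prod>a\<leftarrow>as. - c * (- x / c - a))"
      unfolding as len[symmetric] by (induction as) (auto simp: algebra_simps)
    also have "\<dots> = (\<Prod>a\<leftarrow>as. x + c * a)"
      using False by (simp add: algebra_simps)
    finally show ?thesis .
  qed
qed

text \<open>The sign of \<open>p\<close> enters once for the rows and once for the columns, and its
  square is 1. Columns are treated as rows of the transpose.\<close>

lemma det_permute_rows_columns: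
  fixes A :: "'a::comm_ring_1 mat"
  assumes A: "A \<in> carrier_mat n n" and p: "p permutes {0..<n}"
  shows "det (mat n n (\<lambda>(i, j). A $$ (p i, p j))) = det A"
proof -
  define B where "B = mat n n (\<lambda>(i, j). A $$ (p i, j))"
  define C where "C = mat n n (\<lambda>(i, j). B\<^sup>T $$ (p i, j))"
  have B: "B \<in> carrier_mat n n" "B\<^sup>T \<in> carrier_mat n n" and C: "C \<in> carrier_mat n n"
    by (auto simp: B_def C_def)
  have lt: "p i < n" if "i < n" for i
    using permutes_in_image[OF p, of i] that by simp
  have "mat n n (\<lambda>(i, j). A $$ (p i, p j)) = C\<^sup>T"
    by (intro eq_matI) (auto simp: C_def B_def lt)
  then have "det (mat n n (\<lambda>(i, j). A $$ (p i, p j))) = det C"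
    using det_transpose[OF C] by simp
  also have "\<dots> = signof p * det B"
    using det_permute_rows[OF B(2) p] det_transpose[OF B(1)] by (simp add: C_def)
  also have "\<dots> = (signof p * signof p) * det A"
    using det_permute_rows[OF A p] by (simp add: B_def mult.assoc)
  also have "signof p * signof p = (1 :: 'a)"
    by (cases p rule: sign_cases) simp_all
  finally show ?thesis by simp
qed

text \<open>Cyclicity of the trace, applied to the product of \<open>P * B\<close> and
  \<open>Q\<close>.\<close>

lemma trace_similar:
  fixes A B :: "'a::comm_ring_1 mat"
  assumes "A \<in> carrier_mat n n" and "similar_mat A B"
  shows "(\<Sum>i<n. A $$ (i, i)) = (\<Sum>i<n. B $$ (i, i))"
proof -
  have commute: "(\<Sum>i<n. (X * Y) $$ (i, i)) = (\<Sum>i<n. (Y * X) $$ (i, i))"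
    if "X \<in> carrier_mat n n" "Y \<in> carrier_mat n n" for X Y :: "'a mat"
  proof -
    have "(\<Sum>i<n. (X * Y) $$ (i, i)) = (\<Sum>i<n. \<Sum>j<n. X $$ (i, j) * Y $$ (j, i))"
      using that by (simp add: scalar_prod_def atLeast0LessThan)
    also have "\<dots> = (\<Sum>j<n. \<Sum>i<n. Y $$ (j, i) * X $$ (i, j))"
      by (subst sum.swap) (simp add: mult.commute)
    also have "\<dots> = (\<Sum>i<n. (Y * X) $$ (i, i))"
      using that by (simp add: scalar_prod_def atLeast0LessThan)
    finally show ?thesis .
  qed
  from assms(2) obtain P Q where "similar_mat_wit A B P Q"
    unfolding similar_mat_def by blast
  then have c: "B \<in> carrier_mat n n" "P \<in> carrier_mat n n" "Q \<in> carrier_mat n n"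
    and QP: "Q * P = 1\<^sub>m n" and AB: "A = P * B * Q"
    using similar_mat_witD2[OF assms(1)] by auto
  have "Q * (P * B) = B"
    using assoc_mult_mat[OF c(3,2,1)] c(1) QP by simp
  moreover have "(\<Sum>i<n. A $$ (i, i)) = (\<Sum>i<n. (Q * (P * B)) $$ (i, i))"
    unfolding AB using c by (intro commute) auto
  ultimately show ?thesis by simp
qed

text \<open>Schur decomposition gives a similar matrix whose diagonal is \<open>as\<close>, and
  similarity preserves the trace.\<close>

lemma trace_eq_sum_list:
  fixes A :: "'a::conjugatable_ordered_field mat"
  assumes A: "A \<in> carrier_mat n n" and as: "char_poly A = (\<Prod>a\<leftarrow>as. [:- a, 1:])"
  shows "(\<Sum>i<n. A $$ (i, i)) = sum_list as"
proof -
  obtain B P Q where dec: "schur_decomposition A as = (B, P, Q)"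
    by (cases "schur_decomposition A as")
  then have wit: "similar_mat_wit A B P Q" and diag: "diag_mat B = as"
    using schur_decomposition[OF A as] by auto
  have "B \<in> carrier_mat n n" using similar_mat_witD2[OF A wit] by simp
  then have "sum_list as = (\<Sum>i<n. B $$ (i, i))"
    by (simp add: diag_mat_def interv_sum_list_conv_sum_set_nat atLeast0LessThan
        flip: diag)
  moreover have "similar_mat A B" using wit by (auto simp: similar_mat_def)
  ultimately show ?thesis using trace_similar[OF A] by simp
qed


text \<open>Columns \<open>2 * j\<close> and \<open>2 * j + 1\<close> form one block, which matches
  the interleaving of positions and velocities in the state vector.\<close>

lemma kronecker_mult_vec_index:
  fixes A B :: "'a::comm_semiring_0 mat"
  assumes A: "A \<in> carrier_mat n n" and B: "B \<in> carrier_mat 2 2"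
    and u: "u \<in> carrier_vec (2 * n)" and r: "r < 2 * n"
  shows "(kronecker A B *\<^sub>v u) $ r
    = (\<Sum>j<n. A $$ (r div 2, j)
         * (B $$ (r mod 2, 0) * u $ (2 * j) + B $$ (r mod 2, 1) * u $ (2 * j + 1)))"
proof -
  have pairs: "(\<Sum>c<2 * m. f c) = (\<Sum>j<m. f (2 * j) + f (2 * j + 1))" for f :: "nat \<Rightarrow> 'a" and m
    by (induction m) (simp_all add: ac_simps)
  have "(kronecker A B *\<^sub>v u) $ r
      = (\<Sum>c<2 * n. A $$ (r div 2, c div 2) * B $$ (r mod 2, c mod 2) * u $ c)"
    using A B u r by (simp add: kronecker_def scalar_prod_def atLeast0LessThan mult.commute[of n])
  then show ?thesis unfolding pairs by simp (simp add: algebra_simps)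
qed

section \<open>The graph Laplacian and its spectrum\<close>

lemma laplacian_carrier [simp]: "laplacian n G \<in> carrier_mat n n"
  unfolding laplacian_def degree_mat_def adjacency_mat_def by auto

lemma laplacian_dim [simp]: "dim_row (laplacian n G) = n" "dim_col (laplacian n G) = n"
  by (simp_all add: laplacian_def degree_mat_def adjacency_mat_def)

lemma laplacian_index:
  assumes "i < n" "j < n"
  shows "laplacian n G $$ (i, j)
    = (if i = j then real (card (neighbours G i)) else 0) - (if j \<in> neighbours G i then 1 else 0)"
  using assms by (simp add: laplacian_def degree_mat_def adjacency_mat_def neighbours_def)

lemma neighbours_subset:
  assumes "pair_graph G" and "pverts G = {0..<n}"
  shows "neighbours G i \<subseteq> {..<n}"
proof -
  interpret pair_graph G by fact
  show ?thesis using assms(2) in_arcsD2 wellformed by (auto simp: neighbours_def)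
qed

text \<open>The degree on the diagonal supplies one copy of \<open>v i\<close> per neighbour. The
  values are kept general so that the identity serves both complex eigenvectors and real
  trajectories.\<close>

lemma sum_laplacian_mult:
  fixes v :: "nat \<Rightarrow> 'a::real_algebra_1"
  assumes G: "pair_graph G" "pverts G = {0..<n}" and i: "i < n"
  shows "(\<Sum>j<n. of_real (laplacian n G $$ (i, j)) * v j) = (\<Sum>j\<in>neighbours G i. v i - v j)"
proof -
  let ?N = "neighbours G i"
  have "(\<Sum>j<n. of_real (laplacian n G $$ (i, j)) * v j)
      = (\<Sum>j<n. (if j = i then of_nat (card ?N) * v i else 0) - (if j \<in> ?N then v j else 0))"
    using i by (intro sum.cong) (auto simp: laplacian_index algebra_simps)
  also have "\<dots> = of_nat (card ?N) * v i - (\<Sum>j\<in>?N. v j)"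
    using i neighbours_subset[OF G]
    by (simp add: sum_subtractf Int_absorb1 flip: sum.inter_restrict)
  finally show ?thesis by (simp add: sum_subtractf)
qed

text \<open>The quadratic form of the Laplacian is a sum of squared differences along edges. For an
  eigenvector this gives \<open>2 z R = T\<close> with \<open>R > 0\<close> the squared norm and
  \<open>T \<ge> 0\<close> the sum over arcs.\<close>

lemma laplacian_complex_eigenvalue:
  assumes G: "pair_graph G" "pverts G = {0..<n}"
    and ev: "eigenvalue (map_mat complex_of_real (laplacian n G)) z"
  shows "z \<in> \<real>" and "Re z \<ge> 0"
proof -
  interpret pair_graph G by fact
  let ?A = "map_mat complex_of_real (laplacian n G)"
  \<comment> \<open>Every undirected edge appears in \<open>E\<close> in both directions; this
    symmetry allows the swap of \<open>i\<close> and \<open>j\<close> below.\<close>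
  define E where "E = (SIGMA i:{..<n}. neighbours G i)"
  obtain v where v: "v \<in> carrier_vec n" "v \<noteq> 0\<^sub>v n" "?A *\<^sub>v v = z \<cdot>\<^sub>v v"
    using ev by (auto simp: eigenvalue_def eigenvector_def)
  define R where "R = (\<Sum>i<n. (norm (v $ i))\<^sup>2)"
  define T where "T = (\<Sum>(i, j)\<in>E. (norm (v $ i - v $ j))\<^sup>2)"
  have fin: "finite (neighbours G i)" for i
    using neighbours_subset[OF G] finite_subset by blast
  have "prod.swap ` E = E"
    using pair_sym_arcs wellformed G(2)
    by (force simp: E_def neighbours_def arcs_symmetric)
  then have swap: "(\<Sum>(i, j)\<in>E. f j i) = (\<Sum>(i, j)\<in>E. f i j)" for f :: "nat \<Rightarrow> nat \<Rightarrow> complex"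
    using sum.reindex[of prod.swap E "\<lambda>(i, j). f i j"] by (simp add: case_prod_beta)
  have row: "z * v $ i = (\<Sum>j\<in>neighbours G i. v $ i - v $ j)" if i: "i < n" for i
  proof -
    have "z * v $ i = (?A *\<^sub>v v) $ i" using v i by simp
    also have "\<dots> = (\<Sum>j<n. complex_of_real (laplacian n G $$ (i, j)) * v $ j)"
      using v(1) i by (simp add: scalar_prod_def atLeast0LessThan)
    finally show ?thesis by (simp add: sum_laplacian_mult[OF G i])
  qed
  have "z * complex_of_real R = (\<Sum>i<n. cnj (v $ i) * (z * v $ i))"
    by (simp add: R_def sum_distrib_left complex_norm_square mult_ac del: of_real_power)
  also have "\<dots> = (\<Sum>(i, j)\<in>E. cnj (v $ i) * (v $ i - v $ j))"
    by (simp add: row sum_distrib_left E_def sum.Sigma fin)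
  finally have q: "z * complex_of_real R = (\<Sum>(i, j)\<in>E. cnj (v $ i) * (v $ i - v $ j))" .
  \<comment> \<open>Adding the swapped sum symmetrizes the summand:
    \<open>cnj a * (a - b) + cnj b * (b - a)\<close> equals the squared norm of
    \<open>a - b\<close>.\<close>
  have "2 * (z * complex_of_real R)
      = (\<Sum>(i, j)\<in>E. cnj (v $ i) * (v $ i - v $ j)) + (\<Sum>(i, j)\<in>E. cnj (v $ j) * (v $ j - v $ i))"
    using swap[of "\<lambda>i j. cnj (v $ i) * (v $ i - v $ j)"] q by simp
  also have "\<dots> = complex_of_real T"
    unfolding T_def of_real_sum sum.distrib[symmetric]
    by (intro sum.cong) (auto simp: complex_norm_square algebra_simps simp del: of_real_power)
  finally have zT: "2 * (z * complex_of_real R) = complex_of_real T" .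
  obtain i where "i < n" "v $ i \<noteq> 0"
    using v(1,2) by (metis carrier_vecD eq_vecI index_zero_vec)
  then have R: "R > 0"
    unfolding R_def by (intro sum_pos2[of _ i]) auto
  have "T \<ge> 0" unfolding T_def by (intro sum_nonneg) auto
  have z: "z = complex_of_real (T / (2 * R))"
    using zT R by (simp add: field_simps)
  show "z \<in> \<real>" unfolding z by simp
  show "Re z \<ge> 0" unfolding z using R \<open>T \<ge> 0\<close> by simp
qed

text \<open>Over the complex numbers the polynomial splits; all its roots are real and nonnegative,
  and injectivity of the embedding of polynomials brings the factorization back to the
  reals.\<close>

lemma laplacian_char_poly_splits:
  assumes G: "pair_graph G" "pverts G = {0..<n}"
  obtains as where "char_poly (laplacian n G) = (\<Prod>a\<leftarrow>as. [:- a, 1:])" and "\<forall>a\<in>set as. a \<ge> 0"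
proof -
  let ?L = "laplacian n G" and ?A = "map_mat complex_of_real (laplacian n G)"
  have A: "?A \<in> carrier_mat n n" by simp
  obtain zs where zs: "char_poly ?A = (\<Prod>z\<leftarrow>zs. [:- z, 1:])"
    using char_poly_factorized[OF A] by blast
  have ev: "eigenvalue ?A z" if "z \<in> set zs" for z
    using that zs by (auto simp: eigenvalue_root_char_poly[OF A] poly_prod_list prod_list_zero_iff)
  have real: "map complex_of_real (map Re zs) = zs"
    using laplacian_complex_eigenvalue(1)[OF G ev] by (simp add: map_idI)
  interpret map_of_real: map_poly_inj_idom_hom complex_of_real ..
  have "map_poly complex_of_real (char_poly ?L) = (\<Prod>z\<leftarrow>zs. [:- z, 1:])"
    using of_real_hom.char_poly_hom[OF laplacian_carrier] zs by metis
  also have "\<dots> = map_poly complex_of_real (\<Prod>a\<leftarrow>map Re zs. [:- a, 1:])"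
    by (subst real[symmetric]) (simp add: map_of_real.hom_prod_list o_def)
  finally have "char_poly ?L = (\<Prod>a\<leftarrow>map Re zs. [:- a, 1:])"
    by simp
  moreover have "\<forall>a\<in>set (map Re zs). a \<ge> 0"
    using laplacian_complex_eigenvalue(2)[OF G ev] by auto
  ultimately show thesis using that by blast
qed

text \<open>Since \<open>n \<ge> 2\<close>, vertex 1 exists and is reachable from 0; the first arc
  of a walk there ends in a neighbour of 0.\<close>

lemma connected_imp_neighbours_nonempty:
  assumes n: "n \<ge> 2" and G: "pair_graph G" "pverts G = {0..<n}" "connected (with_proj G)"
  shows "neighbours G 0 \<noteq> {}"
proof -
  interpret pair_graph G by fact
  have "strongly_connected (with_proj G)"
    using G(3) pair_sym_arcs by (intro symmetric_connected_imp_strongly_connected) auto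
  then have "0 \<rightarrow>\<^sup>*\<^bsub>with_proj G\<^esub> 1"
    using n G(2) by (simp add: strongly_connected_def)
  then show ?thesis
    by (rule converse_reachable_cases) (auto simp: neighbours_def)
qed

text \<open>The eigenvalues sum to the trace, which is the sum of the degrees and hence positive, so
  one of them is positive.\<close>

lemma laplacian_pos_eigenvalue:
  assumes n: "n \<ge> 2" and G: "pair_graph G" "pverts G = {0..<n}" "connected (with_proj G)"
  obtains l where "l \<in> spectrum (laplacian n G)" and "l > 0"
proof -
  interpret pair_graph G by fact
  let ?L = "laplacian n G"
  obtain as where as: "char_poly ?L = (\<Prod>a\<leftarrow>as. [:- a, 1:])" "\<forall>a\<in>set as. a \<ge> 0"
    using laplacian_char_poly_splits[OF G(1,2)] .
  have fin: "finite (neighbours G i)" for i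
    using neighbours_subset[OF G(1,2)] finite_subset by blast
  \<comment> \<open>Without loops, nothing is subtracted from the degrees on the diagonal.\<close>
  have "i \<notin> neighbours G i" for i
    using pair_no_loops by (force simp: neighbours_def)
  then have "sum_list as = (\<Sum>i<n. real (card (neighbours G i)))"
    using trace_eq_sum_list[OF laplacian_carrier as(1)] by (simp add: laplacian_index)
  also have "\<dots> > 0"
    using n connected_imp_neighbours_nonempty[OF n G] fin
    by (intro sum_pos2[of _ 0]) (auto simp: card_gt_0_iff)
  finally obtain a where a: "a \<in> set as" "a > 0"
    by (metis less_le_not_le linorder_not_less sum_list_nonpos)
  then have "a \<in> spectrum ?L"
    by (auto simp: spectrum_root_char_poly[OF laplacian_carrier] as(1) poly_prod_list
        prod_list_zero_iff)
  then show thesis using a(2) that by blast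
qed

section \<open>Crossing delays\<close>

text \<open>This is the strict decrease of \<open>arctan x / x\<close>, cleared of denominators. By
  concavity, the mean slope of \<open>arctan\<close> on \<open>[0, x]\<close> exceeds that on
  \<open>[x, y]\<close>.\<close>

lemma mult_arctan_less:
  assumes "0 < x" and "x < y"
  shows "x * arctan y < y * arctan x"
proof -
  obtain a where a: "0 < a" "a < x" "arctan x - arctan 0 = (x - 0) * inverse (1 + a\<^sup>2)"
    using MVT2[OF assms(1) DERIV_arctan] by blast
  obtain b where b: "x < b" "b < y" "arctan y - arctan x = (y - x) * inverse (1 + b\<^sup>2)"
    using MVT2[OF assms(2) DERIV_arctan] by blast
  have "a\<^sup>2 < b\<^sup>2" using a b by (intro power_strict_mono) auto
  then have lt: "inverse (1 + b\<^sup>2) < inverse (1 + a\<^sup>2)"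
    by (intro less_imp_inverse_less) (auto intro: add_pos_nonneg)
  have "x * (arctan y - arctan x) = (x * (y - x)) * inverse (1 + b\<^sup>2)"
    using b by simp
  also have "\<dots> < (x * (y - x)) * inverse (1 + a\<^sup>2)"
    using lt assms by (intro mult_strict_left_mono) auto
  also have "\<dots> = (y - x) * arctan x"
    using a by simp
  finally show ?thesis by (simp add: algebra_simps)
qed

text \<open>The modulus condition for a root on the imaginary axis is quadratic in
  \<open>W = w\<^sup>2\<close>, namely
  \<open>W\<^sup>2 - (l k2)\<^sup>2 W - (l k1)\<^sup>2 = 0\<close>; this is the square root of its
  positive solution.\<close>

definition crossing_frequency :: "real \<Rightarrow> real \<Rightarrow> real \<Rightarrow> real" where
  "crossing_frequency k1 k2 l =
     sqrt (((l * k2)\<^sup>2 + sqrt ((l * k2) ^ 4 + 4 * (l * k1)\<^sup>2)) / 2)"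

text \<open>The delay at which the phase \<open>\<tau> w\<close> first equals the argument of
  \<open>k1 + \<i> k2 w\<close>.\<close>

definition crossing_delay :: "real \<Rightarrow> real \<Rightarrow> real \<Rightarrow> real" where
  "crossing_delay k1 k2 l =
     arctan (k2 * crossing_frequency k1 k2 l / k1) / crossing_frequency k1 k2 l"

lemma crossing_frequency:
  assumes "k1 > 0" and "l > 0"
  shows crossing_frequency_pos: "crossing_frequency k1 k2 l > 0"
    and crossing_frequency_eq:
      "crossing_frequency k1 k2 l ^ 4 = l\<^sup>2 * (k1\<^sup>2 + k2\<^sup>2 * (crossing_frequency k1 k2 l)\<^sup>2)"
proof -
  define d where "d = sqrt ((l * k2) ^ 4 + 4 * (l * k1)\<^sup>2)"
  define W where "W = ((l * k2)\<^sup>2 + d) / 2"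
  have d: "d > 0" "d\<^sup>2 = (l * k2) ^ 4 + 4 * (l * k1)\<^sup>2"
    using assms by (auto simp: d_def intro!: add_nonneg_pos)
  have W: "W > 0"
    using d by (auto simp: W_def intro!: add_nonneg_pos)
  have w: "crossing_frequency k1 k2 l = sqrt W"
    by (simp add: crossing_frequency_def W_def d_def)
  then show "crossing_frequency k1 k2 l > 0" using W by simp
  have sq: "(sqrt W)\<^sup>2 = W" using W by simp
  have "(sqrt W) ^ 4 = W\<^sup>2"
    using sq by (metis power2_eq_square power4_eq_xxxx mult.assoc)
  moreover have "W\<^sup>2 = l\<^sup>2 * (k1\<^sup>2 + k2\<^sup>2 * W)"
  proof -
    \<comment> \<open>Undoing the quadratic formula: \<open>2 * W - (l * k2)\<^sup>2\<close> is the
      root \<open>d\<close> of the discriminant.\<close>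
    have "(2 * W - (l * k2)\<^sup>2)\<^sup>2 = (l * k2) ^ 4 + 4 * (l * k1)\<^sup>2"
      using d(2) by (simp add: W_def add_divide_distrib)
    then show ?thesis by (simp add: algebra_simps power2_eq_square power4_eq_xxxx)
  qed
  ultimately show "crossing_frequency k1 k2 l ^ 4
      = l\<^sup>2 * (k1\<^sup>2 + k2\<^sup>2 * (crossing_frequency k1 k2 l)\<^sup>2)"
    using w sq by simp
qed

text \<open>The quotient \<open>w ^ 4 / (k1\<^sup>2 + k2\<^sup>2 w\<^sup>2)\<close> increases with
  \<open>w > 0\<close> and equals the square of the eigenvalue. The proof cross-multiplies:
  \<open>w \<le> v\<close> would force \<open>m\<^sup>2 \<le> l\<^sup>2\<close>.\<close>

lemma crossing_equation_less:
  fixes k1 k2 l m v w :: real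
  assumes "k1 \<noteq> 0" and "0 \<le> l" and "0 < v" and "0 < w" and "l < m"
    and v: "v ^ 4 = l\<^sup>2 * (k1\<^sup>2 + k2\<^sup>2 * v\<^sup>2)"
    and w: "w ^ 4 = m\<^sup>2 * (k1\<^sup>2 + k2\<^sup>2 * w\<^sup>2)"
  shows "v < w"
proof (rule ccontr)
  assume "\<not> v < w"
  then have le: "w \<le> v" by simp
  define P where "P = (k1\<^sup>2 + k2\<^sup>2 * v\<^sup>2) * (k1\<^sup>2 + k2\<^sup>2 * w\<^sup>2)"
  have P: "P > 0"
    unfolding P_def using assms(1) by (intro mult_pos_pos add_pos_nonneg) auto
  have w2: "w\<^sup>2 \<le> v\<^sup>2" and w4: "w ^ 4 \<le> v ^ 4"
    using le assms(4) by (auto intro!: power_mono)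
  have "v\<^sup>2 * w\<^sup>2 * w\<^sup>2 \<le> v\<^sup>2 * w\<^sup>2 * v\<^sup>2"
    using w2 by (intro mult_left_mono) auto
  then have "k2\<^sup>2 * (v\<^sup>2 * w ^ 4) \<le> k2\<^sup>2 * (w\<^sup>2 * v ^ 4)"
    by (intro mult_left_mono) (auto simp: power2_eq_square power4_eq_xxxx mult_ac)
  moreover have "k1\<^sup>2 * w ^ 4 \<le> k1\<^sup>2 * v ^ 4"
    using w4 by (intro mult_left_mono) auto
  ultimately have "w ^ 4 * (k1\<^sup>2 + k2\<^sup>2 * v\<^sup>2) \<le> v ^ 4 * (k1\<^sup>2 + k2\<^sup>2 * w\<^sup>2)"
    by (simp add: algebra_simps)
  then have "m\<^sup>2 * P \<le> l\<^sup>2 * P"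
    using v w by (simp add: P_def mult_ac)
  then have "m\<^sup>2 \<le> l\<^sup>2" using P by simp
  then show False using assms power_strict_mono[of l m 2] by simp
qed

text \<open>After cross-multiplication the difference of the two equations is
  \<open>v\<^sup>2 - w\<^sup>2\<close> times a positive quantity.\<close>

lemma crossing_equation_unique:
  fixes k1 k2 l v w :: real
  assumes "k1 \<noteq> 0" and "0 < v" and "0 < w"
    and v: "v ^ 4 = l\<^sup>2 * (k1\<^sup>2 + k2\<^sup>2 * v\<^sup>2)"
    and w: "w ^ 4 = l\<^sup>2 * (k1\<^sup>2 + k2\<^sup>2 * w\<^sup>2)"
  shows "v = w"
proof -
  have "v ^ 4 * (k1\<^sup>2 + k2\<^sup>2 * w\<^sup>2) = w ^ 4 * (k1\<^sup>2 + k2\<^sup>2 * v\<^sup>2)"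
    unfolding v w by (simp add: mult_ac)
  then have "(v\<^sup>2 - w\<^sup>2) * (k1\<^sup>2 * (v\<^sup>2 + w\<^sup>2) + k2\<^sup>2 * (v\<^sup>2 * w\<^sup>2)) = 0"
    by (simp add: algebra_simps power2_eq_square power4_eq_xxxx)
  moreover have "k1\<^sup>2 * (v\<^sup>2 + w\<^sup>2) + k2\<^sup>2 * (v\<^sup>2 * w\<^sup>2) > 0"
    using assms by (intro add_pos_nonneg mult_pos_pos) (auto intro: add_pos_pos)
  ultimately have "v\<^sup>2 = w\<^sup>2" by simp
  then show ?thesis using assms power2_eq_iff_nonneg[of v w] by simp
qed

text \<open>With \<open>x = k2 w / k1\<close> the delay is \<open>k2 / k1\<close> times
  \<open>arctan x / x\<close>, a decreasing function of a frequency that grows with the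
  eigenvalue.\<close>

lemma crossing_delay_less:
  assumes k: "k1 > 0" "k2 > 0" and "l > 0" and "l < m"
  shows "crossing_delay k1 k2 m < crossing_delay k1 k2 l"
proof -
  define v w where "v = crossing_frequency k1 k2 l" and "w = crossing_frequency k1 k2 m"
  have pos: "v > 0" "w > 0" and less: "v < w"
    using crossing_frequency[of k1 l k2] crossing_frequency[of k1 m k2] assms
      crossing_equation_less[of k1 l v w m k2] by (auto simp: v_def w_def)
  have "(k2 * v / k1) * arctan (k2 * w / k1) < (k2 * w / k1) * arctan (k2 * v / k1)"
    using pos less k by (intro mult_arctan_less divide_strict_right_mono) auto
  then have "(k2 / k1) * (v * arctan (k2 * w / k1)) < (k2 / k1) * (w * arctan (k2 * v / k1))"
    by (simp add: field_simps)
  then have "v * arctan (k2 * w / k1) < w * arctan (k2 * v / k1)"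
    using k by (subst (asm) mult_less_cancel_left_pos) auto
  then show ?thesis
    using pos by (simp add: crossing_delay_def v_def w_def field_simps)
qed

lemma crossing_delay_pos:
  assumes "k1 > 0" "k2 > 0" "l > 0"
  shows "crossing_delay k1 k2 l > 0"
  using assms crossing_frequency_pos[of k1 l k2] by (simp add: crossing_delay_def)

text \<open>Multiplying the equation by \<open>exp (\<i> \<tau> y)\<close> separates it into a
  cosine and a sine equation. Their squares fix the frequency, their quotient fixes the tangent of
  the phase.\<close>

lemma imaginary_root_delay_ge:
  fixes k1 k2 l \<tau> y :: real
  assumes k: "k1 > 0" "k2 > 0" and l: "l > 0" and \<tau>: "\<tau> > 0"
    and root: "(\<i> * complex_of_real y)\<^sup>2
      + complex_of_real l * (complex_of_real k2 * (\<i> * complex_of_real y) + complex_of_real k1)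
        * exp (- complex_of_real \<tau> * (\<i> * complex_of_real y)) = 0"
  shows "crossing_delay k1 k2 l \<le> \<tau>"
proof -
  define w where "w = \<bar>y\<bar>"
  have cancel: "A * C + B = 0" if "A + B * E = 0" "E * C = 1" for A B C E :: complex
  proof -
    have "(A + B * E) * C = A * C + B * (E * C)" by (simp add: algebra_simps)
    with that show ?thesis by simp
  qed
  have "exp (- complex_of_real \<tau> * (\<i> * complex_of_real y)) * cis (\<tau> * y) = 1"
    by (simp add: cis_conv_exp flip: exp_add)
  from cancel[OF root this] have "(\<i> * complex_of_real y)\<^sup>2 * cis (\<tau> * y)
      + complex_of_real l * (complex_of_real k2 * (\<i> * complex_of_real y) + complex_of_real k1) = 0"
    .
  then have eq: "complex_of_real (y\<^sup>2) * cis (\<tau> * y)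
      = complex_of_real l * (complex_of_real k2 * (\<i> * complex_of_real y) + complex_of_real k1)"
    by (simp add: power_mult_distrib)
  have re: "y\<^sup>2 * cos (\<tau> * y) = l * k1"
    using arg_cong[OF eq, of Re] by simp
  have im: "y\<^sup>2 * sin (\<tau> * y) = l * k2 * y"
    using arg_cong[OF eq, of Im] by (simp flip: of_real_power)
  have y: "y \<noteq> 0" using re k l by auto
  then have w: "w > 0" by (simp add: w_def)
  \<comment> \<open>Both equations are invariant under \<open>y \<mapsto> - y\<close>, as cosine is
    even and sine odd.\<close>
  have c: "w\<^sup>2 * cos (\<tau> * w) = l * k1" and s: "w\<^sup>2 * sin (\<tau> * w) = l * k2 * w"
    using re im by (auto simp: w_def abs_if)
  have "w ^ 4 = (w\<^sup>2 * cos (\<tau> * w))\<^sup>2 + (w\<^sup>2 * sin (\<tau> * w))\<^sup>2"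
  proof -
    have "(w\<^sup>2 * cos (\<tau> * w))\<^sup>2 + (w\<^sup>2 * sin (\<tau> * w))\<^sup>2
        = w ^ 4 * ((sin (\<tau> * w))\<^sup>2 + (cos (\<tau> * w))\<^sup>2)"
      by (simp add: power_mult_distrib distrib_left del: sin_cos_squared_add flip: power_mult)
    then show ?thesis by (simp only: sin_cos_squared_add mult_1_right)
  qed
  then have "w ^ 4 = l\<^sup>2 * (k1\<^sup>2 + k2\<^sup>2 * w\<^sup>2)"
    unfolding c s by (simp add: algebra_simps power2_eq_square)
  then have freq: "w = crossing_frequency k1 k2 l"
    using crossing_equation_unique[of k1 w] crossing_frequency[of k1 l k2] k l w by auto
  have "tan (\<tau> * w) = (w\<^sup>2 * sin (\<tau> * w)) / (w\<^sup>2 * cos (\<tau> * w))"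
    using w by (simp add: tan_def)
  also have "\<dots> = k2 * w / k1"
    unfolding c s using l by simp
  finally have tan: "tan (\<tau> * w) = k2 * w / k1" .
  \<comment> \<open>A smaller positive phase would lie below \<open>pi / 2\<close>, where
    \<open>arctan\<close> inverts \<open>tan\<close> and returns the phase itself.\<close>
  have "arctan (k2 * w / k1) \<le> \<tau> * w"
  proof (rule ccontr)
    assume *: "\<not> arctan (k2 * w / k1) \<le> \<tau> * w"
    then have "\<tau> * w < pi / 2" using arctan_ubound[of "k2 * w / k1"] by linarith
    moreover have "0 < \<tau> * w" using \<tau> w by simp
    ultimately have "arctan (tan (\<tau> * w)) = \<tau> * w" by (intro arctan_tan) auto
    then show False using tan * by simp
  qed
  then show ?thesis
    using w by (simp add: crossing_delay_def freq[symmetric] field_simps)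
qed


section \<open>Destabilizing crossings of the characteristic factors\<close>

lemma char_factor_eq:
  "char_factor k1 k2 l \<tau> s =
     s\<^sup>2 + complex_of_real l * (complex_of_real k2 * s + complex_of_real k1)
       * exp (- complex_of_real \<tau> * s)"
proof -
  define M where "M = s \<cdot>\<^sub>m 1\<^sub>m 2 - map_mat complex_of_real F1
    + (complex_of_real l * exp (- complex_of_real \<tau> * s)) \<cdot>\<^sub>m
        map_mat complex_of_real (F2 k1 k2)"
  have carrier: "M \<in> carrier_mat 2 2"
    by (auto simp: M_def F1_def F2_def mat_of_rows_list_def)
  have "det M = (\<Sum>j<2. M $$ (0, j) * cofactor M 0 j)"
    using laplace_expansion_row[OF carrier, of 0] by simp
  also have "\<dots> = M $$ (0, 0) * M $$ (1, 1) - M $$ (0, 1) * M $$ (1, 0)"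
  proof -
    have "mat_delete M 0 0 \<in> carrier_mat 1 1" "mat_delete M 0 1 \<in> carrier_mat 1 1"
      using carrier by (auto simp: mat_delete_def)
    then show ?thesis
      using carrier by (simp add: numeral_2_eq_2 cofactor_def det_single mat_delete_def)
  qed
  finally show ?thesis
    by (simp add: M_def char_factor_def F1_def F2_def mat_of_rows_list_def
        power2_eq_square algebra_simps)
qed

lemma destabilizing_crossing_ge:
  assumes "k1 > 0" "k2 > 0" "l > 0"
    and "destabilizing_crossing (char_factor k1 k2 l) \<tau>"
  shows "crossing_delay k1 k2 l \<le> \<tau>"
proof -
  from assms(4) obtain z where pos: "\<tau> > 0" and z: "char_factor k1 k2 l \<tau> z = 0" "Re z = 0"
    unfolding destabilizing_crossing_def by force
  then have "z = \<i> * complex_of_real (Im z)"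
    by (simp add: complex_eq_iff)
  with z show ?thesis
    using imaginary_root_delay_ge[OF assms(1-3) pos, of "Im z"] by (simp add: char_factor_eq)
qed

text \<open>The factor is \<open>s\<^sup>2\<close> at every delay, so a branch of roots stays at 0
  and never lies in the open left half-plane.\<close>

lemma no_destabilizing_crossing_zero:
  "\<not> destabilizing_crossing (char_factor k1 k2 0) \<tau>"
proof
  assume "destabilizing_crossing (char_factor k1 k2 0) \<tau>"
  then obtain e r where "e > 0" and root: "\<forall>t\<in>{\<tau> - e<..<\<tau> + e}. char_factor k1 k2 0 t (r t) = 0"
    and neg: "\<forall>t\<in>{\<tau> - e<..<\<tau>}. Re (r t) < 0"
    unfolding destabilizing_crossing_def by blast
  have "r (\<tau> - e / 2) = 0" "Re (r (\<tau> - e / 2)) < 0"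
    using root[rule_format, of "\<tau> - e / 2"] neg[rule_format, of "\<tau> - e / 2"] \<open>e > 0\<close>
    by (auto simp: char_factor_eq)
  then show False by simp
qed

text \<open>Where \<open>- l (k2 s + k1) / s\<^sup>2\<close> lies in the right half-plane, the factor vanishes as soon as the
  delay equals the logarithm of that quotient divided by \<open>s\<close>; a branch of roots is
  therefore a local inverse of this holomorphic function.\<close>

lemma destabilizing_crossing_at_crossing_delay:
  assumes k: "k1 > 0" "k2 > 0" and l: "l > 0"
  shows "destabilizing_crossing (char_factor k1 k2 l) (crossing_delay k1 k2 l)"
proof -
  define w where "w = crossing_frequency k1 k2 l"
  define x where "x = k2 * w / k1"
  define \<theta> where "\<theta> = arctan x"
  define \<tau> where "\<tau> = crossing_delay k1 k2 l"
  define c d u where "c = complex_of_real k1" and "d = complex_of_real k2" and "u = complex_of_real l"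
  define s0 where "s0 = \<i> * complex_of_real w"
  \<comment> \<open>For \<open>s \<noteq> 0\<close> the factor vanishes exactly when
    \<open>exp (\<tau> s) = g s\<close>.\<close>
  define g where "g = (\<lambda>s. - u * (d * s + c) / s\<^sup>2)"
  define h where "h = (\<lambda>s. Ln (g s) / s)"
  \<comment> \<open>On \<open>S\<close> the values of \<open>g\<close> avoid the branch cut of
    \<open>Ln\<close>, so \<open>h\<close> is holomorphic there.\<close>
  define S where "S = - {0} \<inter> g -` {z. Re z > 0}"
  have w: "w > 0" and w4: "w ^ 4 = l\<^sup>2 * (k1\<^sup>2 + k2\<^sup>2 * w\<^sup>2)"
    using crossing_frequency[OF k(1) l, of k2] by (auto simp: w_def)
  have \<tau>: "\<tau> = \<theta> / w" "\<tau> > 0"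
    using crossing_delay_pos[OF k l]
    by (auto simp: \<tau>_def \<theta>_def crossing_delay_def x_def w_def)
  have \<theta>: "-pi < \<theta>" "\<theta> < pi" "cos \<theta> > 0"
    using arctan_bounded[of x] cos_gt_zero_pi[of \<theta>] by (auto simp: \<theta>_def)
  have sin\<theta>: "sin \<theta> = x * cos \<theta>"
    using \<theta>(3) tan_arctan[of x] by (simp add: \<theta>_def tan_def field_simps)
  \<comment> \<open>From \<open>tan \<theta> = x\<close> follows the squared cosine; the frequency
    equation then yields the squared claim, and positivity of both sides removes the
    squares.\<close>
  have cos\<theta>: "w\<^sup>2 * cos \<theta> = l * k1"
  proof -
    have "(cos \<theta>)\<^sup>2 * (1 + x\<^sup>2) = 1"
      using sin_cos_squared_add[of \<theta>] by (simp add: sin\<theta> algebra_simps power_mult_distrib)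
    then have "(cos \<theta>)\<^sup>2 * (k1\<^sup>2 + k2\<^sup>2 * w\<^sup>2) = k1\<^sup>2"
      using k by (simp add: x_def field_simps power_mult_distrib)
    moreover have "(w\<^sup>2 * cos \<theta>)\<^sup>2 = w ^ 4 * (cos \<theta>)\<^sup>2"
      by (simp add: power_mult_distrib flip: power_mult)
    ultimately have "(w\<^sup>2 * cos \<theta>)\<^sup>2 = (l * k1)\<^sup>2"
      unfolding w4 by (simp add: power_mult_distrib mult_ac)
    then show ?thesis
      using k l w \<theta>(3) by (simp add: power2_eq_iff_nonneg)
  qed
  have s0: "s0 \<noteq> 0" "Re s0 = 0" using w by (auto simp: s0_def)
  have g0: "g s0 = cis \<theta>"
  proof -
    have "complex_of_real (w\<^sup>2) * cis \<theta> = u * (d * s0 + c)"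
      using cos\<theta> k by (simp add: complex_eq_iff u_def d_def c_def s0_def sin\<theta> x_def mult_ac
          flip: of_real_power)
    then show ?thesis
      using w by (simp add: g_def s0_def power_mult_distrib field_simps)
  qed
  \<comment> \<open>The bounds on \<open>\<theta>\<close> select the principal branch.\<close>
  have Ln0: "Ln (g s0) = \<i> * \<theta>"
    using \<theta> by (intro Ln_unique) (auto simp: g0 cis_conv_exp)
  have h0: "h s0 = complex_of_real \<tau>"
    unfolding h_def Ln0 using w by (simp add: \<tau> s0_def)
  have contg: "continuous_on (- {0}) g"
    unfolding g_def by (intro continuous_intros) auto
  have S: "open S" "s0 \<in> S"
    using \<theta>(3) s0 continuous_open_preimage[OF contg _ open_halfspace_Re_gt[of 0]]
    by (auto simp: S_def g0)
  have gS: "g s \<notin> \<real>\<^sub>\<le>\<^sub>0" "g s \<noteq> 0" "s \<noteq> 0" if "s \<in> S" for s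
    using that by (auto simp: S_def complex_nonpos_Reals_iff)
  have "g holomorphic_on S"
    unfolding g_def using gS(3) by (intro holomorphic_intros) auto
  then have hol: "h holomorphic_on S"
    unfolding h_def using gS by (intro holomorphic_intros) auto
  \<comment> \<open>The derivative of \<open>h\<close> at \<open>s0\<close>: the quotient rule gives
    \<open>(g' / g - h) / s\<close>, with \<open>h s0 = \<tau>\<close>.\<close>
  define D where "D = (d / (d * s0 + c) - 2 / s0 - complex_of_real \<tau>) / s0"
  have nz: "d * s0 + c \<noteq> 0"
    using k by (auto simp: complex_eq_iff d_def c_def s0_def)
  \<comment> \<open>Written as \<open>g\<close> times its logarithmic derivative, so that the
    derivative of \<open>Ln (g s)\<close> can be read off.\<close>
  have "(g has_field_derivative g s0 * (d / (d * s0 + c) - 2 / s0)) (at s0)"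
  proof -
    have deriv: "(g has_field_derivative - u * d / s0\<^sup>2 + 2 * u * (d * s0 + c) / s0 ^ 3) (at s0)"
      unfolding g_def using s0
      by (auto intro!: derivative_eq_intros simp: divide_simps power2_eq_square power3_eq_cube)
        (simp add: algebra_simps)
    have eq: "- u * d / s0\<^sup>2 + 2 * u * K / s0 ^ 3 = (- u * K / s0\<^sup>2) * (d / K - 2 / s0)"
      if "K \<noteq> 0" for K
      using that s0 by (simp add: field_simps power2_eq_square power3_eq_cube)
    show ?thesis
      using deriv unfolding eq[OF nz] by (simp only: g_def)
  qed
  then have "((\<lambda>s. Ln (g s)) has_field_derivative (d / (d * s0 + c) - 2 / s0)) (at s0)"
    using gS[OF S(2)] by (auto intro!: derivative_eq_intros)
  then have "(h has_field_derivative ((d / (d * s0 + c) - 2 / s0) * s0 - Ln (g s0) * 1) / (s0 * s0))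
      (at s0)"
    unfolding h_def by (rule DERIV_divide[OF _ DERIV_ident s0(1)])
  moreover have "Ln (g s0) = complex_of_real \<tau> * s0"
    using h0 s0 by (simp add: h_def field_simps)
  ultimately have Dh: "(h has_field_derivative D) (at s0)"
    using s0 by (simp add: D_def flip: left_diff_distrib)
  have ReD: "Re D > 0"
  proof -
    define q where "q = k1\<^sup>2 + k2\<^sup>2 * w\<^sup>2"
    have q: "q > 0" using k by (auto simp: q_def intro!: add_pos_nonneg)
    have "D = (d * (c - d * s0) / complex_of_real q - 2 / s0 - complex_of_real \<tau>) / s0"
    proof -
      have eq: "(d * s0 + c) * (c - d * s0) = complex_of_real q"
        by (simp add: q_def s0_def c_def d_def algebra_simps power2_eq_square)
      have frac: "d / X = d * Y / Q" if "X * Y = Q" "Q \<noteq> 0" for X Y Q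
        using that by (auto simp: field_simps)
      have "d / (d * s0 + c) = d * (c - d * s0) / complex_of_real q"
        using q by (intro frac[OF eq]) simp
      then show ?thesis by (simp add: D_def)
    qed
    \<comment> \<open>As \<open>s0\<close> is imaginary, the term \<open>\<tau> / s0\<close> drops
      out of the real part. What remains is positive because
      \<open>k2\<^sup>2 w\<^sup>2 < q\<close>.\<close>
    also have "Re \<dots> = 2 / w\<^sup>2 - k2\<^sup>2 / q"
      using w q by (simp add: s0_def c_def d_def Re_divide Im_divide power2_eq_square field_simps)
    finally have "Re D = 2 / w\<^sup>2 - k2\<^sup>2 / q" .
    moreover have "k2\<^sup>2 / q < 2 / w\<^sup>2"
      using k w q by (simp add: field_simps q_def) (simp add: add_pos_nonneg)
    ultimately show ?thesis by simp
  qed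
  then have D: "D \<noteq> 0" by auto
  have "deriv h s0 \<noteq> 0" using Dh D by (simp add: DERIV_imp_deriv)
  then obtain \<rho> where \<rho>: "\<rho> > 0" "ball s0 \<rho> \<subseteq> S" "open (h ` ball s0 \<rho>)" "inj_on h (ball s0 \<rho>)"
    using has_complex_derivative_locally_invertible[OF hol S(2,1)] by metis
  define B where "B = ball s0 \<rho>"
  have B: "open B" "s0 \<in> B" "B \<subseteq> S" "open (h ` B)" "inj_on h B"
    using \<rho> by (auto simp: B_def)
  have holB: "h holomorphic_on B" using hol B(3) holomorphic_on_subset by blast
  \<comment> \<open>The inverse \<open>f\<close> of \<open>h\<close> sends a delay to a root; its
    restriction to real delays is the branch sought.\<close>
  obtain f where f: "f holomorphic_on h ` B" "\<And>z. z \<in> B \<Longrightarrow> deriv h z * deriv f (h z) = 1"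
      "\<And>z. z \<in> B \<Longrightarrow> f (h z) = z"
    using holomorphic_has_inverse[OF holB B(1,5)] by metis
  have "(f has_field_derivative deriv f (h s0)) (at (h s0))"
    using B(2) by (intro holomorphic_derivI[OF f(1) B(4)]) auto
  moreover have "deriv f (h s0) = 1 / D"
    using f(2)[OF B(2)] D DERIV_imp_deriv[OF Dh] by (simp add: field_simps)
  ultimately have "(f has_field_derivative 1 / D) (at (complex_of_real \<tau>))"
    by (simp add: h0)
  then have "((\<lambda>t. f (complex_of_real t)) has_vector_derivative 1 / D) (at \<tau>)"
    by (rule has_vector_derivative_real_field)
  then have "((\<lambda>t. Re (f (complex_of_real t))) has_vector_derivative Re (1 / D)) (at \<tau>)"
    by (rule bounded_linear.has_vector_derivative[OF bounded_linear_Re])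
  then have deriv: "DERIV (\<lambda>t. Re (f (complex_of_real t))) \<tau> :> Re (1 / D)"
    by (simp add: has_real_derivative_iff_has_vector_derivative)
  \<comment> \<open>Inversion preserves the sign of the real part, so the real part of the branch
    increases through 0 at \<open>\<tau>\<close>.\<close>
  have "Re (1 / D) > 0"
    using ReD D by (simp add: Re_divide add_pos_nonneg)
  then obtain a b where "a > 0" "b > 0"
    and right: "\<forall>t>0. t < a \<longrightarrow> Re (f (complex_of_real \<tau>)) < Re (f (complex_of_real (\<tau> + t)))"
    and left: "\<forall>t>0. t < b \<longrightarrow> Re (f (complex_of_real (\<tau> - t))) < Re (f (complex_of_real \<tau>))"
    using DERIV_pos_inc_right[OF deriv] DERIV_pos_inc_left[OF deriv] by blast
  have f\<tau>: "f (complex_of_real \<tau>) = s0"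
    using f(3)[OF B(2)] by (simp add: h0)
  have "complex_of_real \<tau> \<in> h ` B" using B(2) h0 by (metis imageI)
  then obtain \<epsilon> where \<epsilon>: "\<epsilon> > 0" "ball (complex_of_real \<tau>) \<epsilon> \<subseteq> h ` B"
    using B(4) open_contains_ball by blast
  \<comment> \<open>\<open>a\<close> and \<open>b\<close> secure the signs on the two sides,
    \<open>\<epsilon>\<close> keeps the delays in the domain of \<open>f\<close>, and
    \<open>\<tau>\<close> keeps them positive.\<close>
  define e where "e = Min {a, b, \<epsilon>, \<tau>}"
  have e: "0 < e" "e \<le> a" "e \<le> b" "e \<le> \<epsilon>" "e \<le> \<tau>"
    using \<open>a > 0\<close> \<open>b > 0\<close> \<epsilon>(1) \<tau>(2) by (auto simp: e_def)
  have mem: "complex_of_real t \<in> h ` B" if "t \<in> {\<tau> - e<..<\<tau> + e}" for t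
  proof -
    have "dist (complex_of_real \<tau>) (complex_of_real t) < \<epsilon>"
      using that e(4) by (auto simp: dist_real_def abs_less_iff)
    then show ?thesis using \<epsilon>(2) by auto
  qed
  define r where "r = (\<lambda>t. f (complex_of_real t))"
  have "continuous_on {\<tau> - e<..<\<tau> + e} r"
    unfolding r_def using mem
    by (intro continuous_on_compose2[OF holomorphic_on_imp_continuous_on[OF f(1)]])
      (auto intro!: continuous_intros)
  moreover have "char_factor k1 k2 l t (r t) = 0" if t: "t \<in> {\<tau> - e<..<\<tau> + e}" for t
  proof -
    obtain z where z: "z \<in> B" "complex_of_real t = h z" using mem[OF t] by auto
    then have r: "r t = z" using f(3) by (simp add: r_def)
    note gz = gS[OF subsetD[OF B(3) z(1)]]
    have "complex_of_real t * z = Ln (g z)"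
      using z(2) gz by (simp add: h_def)
    then have "exp (- complex_of_real t * z) = 1 / g z"
      using gz by (simp add: exp_minus divide_inverse)
    moreover have "u * (d * z + c) = - g z * z\<^sup>2"
      using gz by (simp add: g_def)
    ultimately show ?thesis
      using gz by (simp add: char_factor_eq r flip: u_def d_def c_def)
  qed
  moreover have "Re (r t) < 0" if "t \<in> {\<tau> - e<..<\<tau>}" for t
    using left[rule_format, of "\<tau> - t"] that e s0 f\<tau> by (auto simp: r_def)
  moreover have "Re (r t) > 0" if "t \<in> {\<tau><..<\<tau> + e}" for t
    using right[rule_format, of "t - \<tau>"] that e s0 f\<tau> by (auto simp: r_def)
  moreover have "Re (r \<tau>) = 0" using f\<tau> s0 by (simp add: r_def)
  ultimately have "destabilizing_crossing (char_factor k1 k2 l) \<tau>"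
    unfolding destabilizing_crossing_def using e \<tau>(2) by blast
  then show ?thesis by (simp add: \<tau>_def)
qed

section \<open>The closed loop and its characteristic function\<close>

lemma F1_F2_carrier [simp]: "F1 \<in> carrier_mat 2 2" "F2 k1 k2 \<in> carrier_mat 2 2"
  by (auto simp: F1_def F2_def mat_of_rows_list_def)

lemma F1_F2_dim [simp]:
  "dim_row F1 = 2" "dim_col F1 = 2" "dim_row (F2 k1 k2) = 2" "dim_col (F2 k1 k2) = 2"
  by (simp_all add: F1_def F2_def mat_of_rows_list_def)

lemma F1_F2_index [simp]:
  "F1 $$ (0, 0) = 0" "F1 $$ (0, Suc 0) = 1" "F1 $$ (Suc 0, 0) = 0" "F1 $$ (Suc 0, Suc 0) = 0"
  "F2 k1 k2 $$ (0, 0) = 0" "F2 k1 k2 $$ (0, Suc 0) = 0"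
  "F2 k1 k2 $$ (Suc 0, 0) = k1" "F2 k1 k2 $$ (Suc 0, Suc 0) = k2"
  by (simp_all add: F1_def F2_def mat_of_rows_list_def)

lemma kronecker_carrier:
  "A \<in> carrier_mat n n \<Longrightarrow> B \<in> carrier_mat 2 2 \<Longrightarrow> kronecker A B \<in> carrier_mat (2 * n) (2 * n)"
  by (rule carrier_matI) (auto simp: kronecker_def)

text \<open>\<open>F1\<close> acts only in its upper row and \<open>F2\<close> only in its lower
  row. So position rows see the present state alone and velocity rows the delayed state
  alone.\<close>

lemma closed_loop_rhs:
  fixes k1 k2 :: real
  assumes G: "pair_graph G" "pverts G = {0..<n}" and i: "i < n"
    and X: "X \<in> carrier_vec (2 * n)" and Y: "Y \<in> carrier_vec (2 * n)"
  defines "rhs \<equiv> kronecker (1\<^sub>m n) F1 *\<^sub>v X + kronecker (- laplacian n G) (F2 k1 k2) *\<^sub>v Y"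
  shows "rhs $ (2 * i) = X $ (2 * i + 1)"
    and "rhs $ (2 * i + 1) = k1 * (\<Sum>j\<in>neighbours G i. Y $ (2 * j) - Y $ (2 * i))
        + k2 * (\<Sum>j\<in>neighbours G i. Y $ (2 * j + 1) - Y $ (2 * i + 1))"
proof -
  let ?L = "laplacian n G"
  \<comment> \<open>The delayed output of an agent, a single scalar on which the Laplacian
    acts.\<close>
  define w where "w = (\<lambda>j. k1 * Y $ (2 * j) + k2 * Y $ (2 * j + 1))"
  have L: "- ?L \<in> carrier_mat n n" by simp
  have lt: "2 * i < 2 * n" "2 * i + 1 < 2 * n" using i by auto
  have delta: "(\<Sum>j<n. (if i = j then 1 else 0) * f j) = f i" for f :: "nat \<Rightarrow> real"
  proof -
    have "(\<Sum>j<n. (if i = j then 1 else 0) * f j) = (\<Sum>j<n. if j = i then f j else 0)"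
      using i by (intro sum.cong) auto
    then show ?thesis using i by simp
  qed
  have rhs: "rhs $ r = (kronecker (1\<^sub>m n) F1 *\<^sub>v X) $ r + (kronecker (- ?L) (F2 k1 k2) *\<^sub>v Y) $ r"
    if "r < 2 * n" for r
    using kronecker_carrier[OF L F1_F2_carrier(2)[of k1 k2]] that unfolding rhs_def
    by (intro index_add_vec) auto
  show "rhs $ (2 * i) = X $ (2 * i + 1)"
    using lt by (simp add: rhs kronecker_mult_vec_index[OF one_carrier_mat F1_F2_carrier(1) X]
        kronecker_mult_vec_index[OF L F1_F2_carrier(2) Y] delta)
  have "rhs $ (2 * i + 1) = (\<Sum>j<n. (- ?L) $$ (i, j) * w j)"
    using lt by (simp add: rhs kronecker_mult_vec_index[OF one_carrier_mat F1_F2_carrier(1) X]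
        kronecker_mult_vec_index[OF L F1_F2_carrier(2) Y] w_def)
  also have "\<dots> = - (\<Sum>j<n. of_real (?L $$ (i, j)) * w j)"
    using i by (simp add: sum_negf)
  also have "\<dots> = (\<Sum>j\<in>neighbours G i. w j - w i)"
    by (simp only: sum_laplacian_mult[OF G i] sum_negf[symmetric] minus_diff_eq)
  also have "\<dots> = k1 * (\<Sum>j\<in>neighbours G i. Y $ (2 * j) - Y $ (2 * i))
        + k2 * (\<Sum>j\<in>neighbours G i. Y $ (2 * j + 1) - Y $ (2 * i + 1))"
    unfolding sum_distrib_left sum.distrib[symmetric]
    by (intro sum.cong) (simp_all add: w_def algebra_simps)
  finally show "rhs $ (2 * i + 1) = \<dots>" .
qed

text \<open>The even rows of the closed loop hold already because \<open>v\<close> is the derivative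
  of \<open>x\<close>; the odd rows are the protocol itself.\<close>

lemma follows_protocol_iff_closed_loop:
  assumes G: "pair_graph G" "pverts G = {0..<n}" and "\<tau> \<ge> 0" and vel: "velocities_of n \<tau> x v"
  shows "follows_protocol n G k1 k2 \<tau> x v \<longleftrightarrow> closed_loop n G k1 k2 \<tau> (state n x v)"
proof -
  define rhs where "rhs = (\<lambda>t. kronecker (1\<^sub>m n) F1 *\<^sub>v state n x v t
    + kronecker (- laplacian n G) (F2 k1 k2) *\<^sub>v state n x v (t - \<tau>))"
  have rhs_eq: "kronecker (1\<^sub>m n) F1 *\<^sub>v state n x v t
    + kronecker (- laplacian n G) (F2 k1 k2) *\<^sub>v state n x v (t - \<tau>) = rhs t" for t
    by (simp add: rhs_def)
  have carrier: "state n x v t \<in> carrier_vec (2 * n)" for t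
    by (simp add: state_def)
  have st: "state n x v t $ (2 * j) = x j t" "state n x v t $ (2 * j + 1) = v j t"
    if "j < n" for j t
    using that by (auto simp: state_def)
  have even: "rhs t $ (2 * i) = v i t" if "i < n" for i t
    using closed_loop_rhs(1)[OF G that carrier carrier] st[OF that] by (simp add: rhs_def)
  have odd: "rhs t $ (2 * i + 1) = protocol G k1 k2 \<tau> x v i t" if i: "i < n" for i t
  proof -
    have "j < n" if "j \<in> neighbours G i" for j
      using neighbours_subset[OF G] that by auto
    then show ?thesis
      using closed_loop_rhs(2)[OF G i carrier carrier] i
      by (simp add: rhs_def protocol_def st[simplified])
  qed
  have "(x i has_real_derivative v i t) (at t within {0..})" if "i < n" "t \<ge> 0" for i t
  proof (rule DERIV_subset)
    show "(x i has_real_derivative v i t) (at t within {- \<tau>..})"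
      using vel that \<open>\<tau> \<ge> 0\<close> by (simp add: velocities_of_def)
    show "{0..} \<subseteq> {- \<tau>..}" using \<open>\<tau> \<ge> 0\<close> by simp
  qed
  then have pos: "((\<lambda>t. state n x v t $ (2 * i)) has_real_derivative rhs t $ (2 * i))
      (at t within {0..})" if "i < n" "t \<ge> 0" for i t
    using that by (simp add: st even)
  have vel': "((\<lambda>t. state n x v t $ (2 * i + 1)) has_real_derivative rhs t $ (2 * i + 1))
      (at t within {0..}) \<longleftrightarrow>
      (v i has_real_derivative protocol G k1 k2 \<tau> x v i t) (at t within {0..})"
    if "i < n" for i t
    using that by (simp only: st odd)
  have split: "(\<forall>r<2 * n. P r) \<longleftrightarrow> (\<forall>i<n. P (2 * i) \<and> P (2 * i + 1))" for P
  proof (intro iffI allI impI)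
    fix r assume *: "\<forall>i<n. P (2 * i) \<and> P (2 * i + 1)" and "r < 2 * n"
    then have "r div 2 < n" by simp
    with * have "P (2 * (r div 2))" "P (2 * (r div 2) + 1)" by blast+
    then show "P r" by (cases "even r") auto
  qed auto
  show ?thesis
    unfolding closed_loop_def rhs_eq split[where P = "\<lambda>r. \<forall>t\<ge>0.
        ((\<lambda>t. state n x v t $ r) has_real_derivative rhs t $ r) (at t within {0..})"]
    by (simp only: follows_protocol_def pos vel' simp_thms cong: imp_cong)
qed

text \<open>Sorting the positions before the velocities turns the matrix into four commuting blocks.\<close>

lemma characteristic_fun_eq_det:
  "characteristic_fun n G k1 k2 \<tau> s
    = det (s\<^sup>2 \<cdot>\<^sub>m 1\<^sub>m n
        + ((complex_of_real k2 * s + complex_of_real k1) * exp (- complex_of_real \<tau> * s))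
          \<cdot>\<^sub>m map_mat complex_of_real (laplacian n G))"
proof -
  define L where "L = map_mat complex_of_real (laplacian n G)"
  define E where "E = exp (- complex_of_real \<tau> * s)"
  define M where "M = s \<cdot>\<^sub>m 1\<^sub>m (2 * n)
    - map_mat complex_of_real (kronecker (1\<^sub>m n) F1)
    - E \<cdot>\<^sub>m map_mat complex_of_real (kronecker (- laplacian n G) (F2 k1 k2))"
  \<comment> \<open>New indices below \<open>n\<close> are the positions, the next \<open>n\<close>
    the velocities; beyond \<open>2 * n\<close> the identity makes \<open>p\<close> a permutation of
    all naturals.\<close>
  define p where "p = (\<lambda>r. if r < n then 2 * r else if r < 2 * n then 2 * (r - n) + 1 else r)"
  define A where "A = s \<cdot>\<^sub>m (1\<^sub>m n :: complex mat)"
  define B where "B = - (1\<^sub>m n :: complex mat)"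
  define C where "C = (E * complex_of_real k1) \<cdot>\<^sub>m L"
  define D where "D = s \<cdot>\<^sub>m 1\<^sub>m n + (E * complex_of_real k2) \<cdot>\<^sub>m L"
  have L: "L \<in> carrier_mat n n" by (simp add: L_def)
  have carrier: "A \<in> carrier_mat n n" "B \<in> carrier_mat n n" "C \<in> carrier_mat n n" "D \<in> carrier_mat n n"
    using L by (auto simp: A_def B_def C_def D_def)
  have M: "M \<in> carrier_mat (2 * n) (2 * n)"
    using kronecker_carrier[of "- laplacian n G" n "F2 k1 k2"] by (auto simp: M_def)
  have "inj_on p {0..<2 * n}"
    by (auto simp: inj_on_def p_def split: if_splits) presburger+
  moreover have "p ` {0..<2 * n} \<subseteq> {0..<2 * n}"
    by (auto simp: p_def)
  ultimately have "bij_betw p {0..<2 * n} {0..<2 * n}"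
    by (simp add: bij_betw_def endo_inj_surj)
  then have p: "p permutes {0..<2 * n}"
    by (intro bij_imp_permutes) (auto simp: p_def)
  have "mat (2 * n) (2 * n) (\<lambda>(i, j). M $$ (p i, p j)) = four_block_mat A B C D" (is "?P = ?Q")
  proof (rule eq_matI)
    fix i j assume "i < dim_row ?Q" "j < dim_col ?Q"
    then have ij: "i < 2 * n" "j < 2 * n" using carrier by auto
    then have plt: "p i < 2 * n" "p j < 2 * n" by (auto simp: p_def)
    have "M $$ (p i, p j) = (if p i = p j then s else 0)
      - complex_of_real (1\<^sub>m n $$ (p i div 2, p j div 2) * F1 $$ (p i mod 2, p j mod 2))
      - E * complex_of_real ((- laplacian n G) $$ (p i div 2, p j div 2)
          * F2 k1 k2 $$ (p i mod 2, p j mod 2))"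
      using plt by (simp add: M_def kronecker_def mult.commute[of n])
    \<comment> \<open>By parity a position index never equals a velocity index, so \<open>s\<close>
      does not occur in the off-diagonal blocks.\<close>
    moreover have "Suc (2 * a) \<noteq> 2 * b" for a b :: nat by presburger
    ultimately show "?P $$ (i, j) = ?Q $$ (i, j)"
      using ij carrier L
      by (cases "i < n"; cases "j < n")
        (auto simp: p_def A_def B_def C_def D_def L_def)
  qed (use carrier in auto)
  then have "det M = det (four_block_mat A B C D)"
    using det_permute_rows_columns[OF M p] by simp
  \<comment> \<open>The block formula needs \<open>C\<close> and \<open>D\<close> to commute; both
    are polynomials in \<open>L\<close>.\<close>
  also have "\<dots> = det (A * D - B * C)"
  proof (rule det_four_block_mat[OF carrier])
    have "L * D = s \<cdot>\<^sub>m L + (E * complex_of_real k2) \<cdot>\<^sub>m (L * L)"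
      unfolding D_def using L
      by (simp add: mult_add_distrib_mat[of L n n _ n] mult_smult_distrib[of L n n _ n])
    moreover have "D * L = s \<cdot>\<^sub>m L + (E * complex_of_real k2) \<cdot>\<^sub>m (L * L)"
      unfolding D_def using L
      by (simp add: add_mult_distrib_mat[of _ n n _ L n] mult_smult_assoc_mat[of _ n n L n])
    ultimately show "C * D = D * C"
      using L carrier(4)
      by (simp add: C_def mult_smult_assoc_mat[of L n n _ n] mult_smult_distrib[of _ n n L n])
  qed
  also have "A * D - B * C = s\<^sup>2 \<cdot>\<^sub>m 1\<^sub>m n + ((complex_of_real k2 * s + complex_of_real k1) * E) \<cdot>\<^sub>m L"
  proof -
    have "A * D = s \<cdot>\<^sub>m D" "B * C = - C"
      using carrier by (auto simp: A_def B_def mult_smult_assoc_mat[of _ n n _ n])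
    then show ?thesis
      using L by (intro eq_matI) (auto simp: C_def D_def power2_eq_square algebra_simps)
  qed
  finally show ?thesis
    by (simp add: characteristic_fun_def M_def E_def L_def)
qed

text \<open>The determinant is that of a linear polynomial in the Laplacian, so it splits over the
  eigenvalue list; equal eigenvalues are then collected.\<close>

lemma characteristic_fun_eq_prod:
  assumes G: "pair_graph G" "pverts G = {0..<n}"
  shows "characteristic_fun n G k1 k2 \<tau> s = (\<Prod>l\<in>spectrum (laplacian n G).
    char_factor k1 k2 l \<tau> s ^ order l (char_poly (laplacian n G)))"
proof -
  let ?L = "laplacian n G" and ?A = "map_mat complex_of_real (laplacian n G)"
  define c where "c = (complex_of_real k2 * s + complex_of_real k1) * exp (- complex_of_real \<tau> * s)"
  obtain as where as: "char_poly ?L = (\<Prod>a\<leftarrow>as. [:- a, 1:])"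
    using laplacian_char_poly_splits[OF G] by blast
  interpret map_of_real: map_poly_inj_idom_hom complex_of_real ..
  have "char_poly ?A = (\<Prod>a\<leftarrow>map complex_of_real as. [:- a, 1:])"
    unfolding of_real_hom.char_poly_hom[OF laplacian_carrier] as
    by (simp add: map_of_real.hom_prod_list o_def)
  then have "characteristic_fun n G k1 k2 \<tau> s = (\<Prod>a\<leftarrow>map complex_of_real as. s\<^sup>2 + c * a)"
    unfolding characteristic_fun_eq_det c_def
    by (intro det_smult_one_add_smult) simp_all
  also have "\<dots> = (\<Prod>l\<leftarrow>as. char_factor k1 k2 l \<tau> s)"
    by (simp add: char_factor_eq c_def o_def mult_ac)
  also have "\<dots> = (\<Prod>l\<in>spectrum ?L. char_factor k1 k2 l \<tau> s ^ order l (char_poly ?L))"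
    unfolding spectrum_root_char_poly[OF laplacian_carrier]
    by (rule prod_list_map_eq_prod_power_order[OF as])
  finally show ?thesis .
qed

section \<open>The largest eigenvalue as the most exigent one\<close>

lemma spectrum_laplacian_nonneg:
  assumes "pair_graph G" "pverts G = {0..<n}" and "l \<in> spectrum (laplacian n G)"
  shows "l \<ge> 0"
proof -
  obtain as where "char_poly (laplacian n G) = (\<Prod>a\<leftarrow>as. [:- a, 1:])" "\<forall>a\<in>set as. a \<ge> 0"
    using laplacian_char_poly_splits[OF assms(1,2)] .
  then show ?thesis
    using assms(3)
    by (auto simp: spectrum_root_char_poly[OF laplacian_carrier] poly_prod_list prod_list_zero_iff)
qed

text \<open>Each factor that crosses at all has a positive eigenvalue and does not cross before its
  crossing delay; the maximum \<open>m\<close> attains its own, the least of these delays. Strict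
  monotonicity excludes any other eigenvalue.\<close>

lemma most_exigent_iff:
  assumes n: "n \<ge> 2" and k: "k1 > 0" "k2 > 0"
    and G: "pair_graph G" "pverts G = {0..<n}" "connected (with_proj G)"
  shows "most_exigent n G k1 k2 l \<longleftrightarrow> l = Max (spectrum (laplacian n G))"
proof -
  let ?S = "spectrum (laplacian n G)"
  define m where "m = Max ?S"
  obtain l0 where l0: "l0 \<in> ?S" "l0 > 0" using laplacian_pos_eigenvalue[OF n G] .
  have fin: "finite ?S" by (rule card_finite_spectrum(1)[OF laplacian_carrier])
  have le: "l' \<le> m" if "l' \<in> ?S" for l'
    using fin that by (simp add: m_def)
  have m: "m > 0" using le[OF l0(1)] l0(2) by simp
  have mem: "m \<in> ?S" using fin l0(1) Max_in by (auto simp: m_def)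
  have cross: "destabilizing_crossing (char_factor k1 k2 m) (crossing_delay k1 k2 m)"
    by (rule destabilizing_crossing_at_crossing_delay[OF k m])
  have bound: "l' > 0" "crossing_delay k1 k2 l' \<le> \<tau>'"
    if "l' \<in> ?S" "destabilizing_crossing (char_factor k1 k2 l') \<tau>'" for l' \<tau>'
  proof -
    show pos: "l' > 0"
      using spectrum_laplacian_nonneg[OF G(1,2) that(1)] no_destabilizing_crossing_zero that(2)
      by (cases "l' = 0") auto
    show "crossing_delay k1 k2 l' \<le> \<tau>'"
      by (rule destabilizing_crossing_ge[OF k pos that(2)])
  qed
  show ?thesis
  proof
    assume "l = Max ?S"
    moreover have "crossing_delay k1 k2 m \<le> \<tau>'"
      if "l' \<in> ?S" "destabilizing_crossing (char_factor k1 k2 l') \<tau>'" for l' \<tau>'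
      using bound[OF that] crossing_delay_less[OF k, of l' m] le[OF that(1)]
      by (cases "l' = m") auto
    ultimately show "most_exigent n G k1 k2 l"
      unfolding most_exigent_def using mem cross by (auto simp: m_def)
  next
    assume "most_exigent n G k1 k2 l"
    then obtain \<tau> where l: "l \<in> ?S" and \<tau>: "destabilizing_crossing (char_factor k1 k2 l) \<tau>"
      and min: "\<forall>l'\<in>?S. \<forall>\<tau>'. destabilizing_crossing (char_factor k1 k2 l') \<tau>' \<longrightarrow> \<tau> \<le> \<tau>'"
      unfolding most_exigent_def by blast
    \<comment> \<open>The crossing at \<open>\<tau>\<close> lies between: not before the crossing
      delay of \<open>l\<close>, and by minimality not after that of \<open>m\<close>.\<close>
    have "crossing_delay k1 k2 l \<le> crossing_delay k1 k2 m"
      using bound(2)[OF l \<tau>] min mem cross by fastforce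
    then have "\<not> l < m"
      using crossing_delay_less[OF k bound(1)[OF l \<tau>], of m] by auto
    then show "l = Max ?S"
      using le[OF l] by (simp add: m_def)
  qed
qed

theorem lemma2:
  fixes n :: nat and G :: "nat pair_pre_digraph" and k1 k2 :: real
  assumes "n \<ge> 2"
    and "k1 > 0" and "k2 > 0"
    and "pair_graph G" and "pverts G = {0..<n}" and "connected (with_proj G)"
  shows "(\<forall>\<tau>\<ge>0. \<forall>x v. velocities_of n \<tau> x v \<longrightarrow>
            (follows_protocol n G k1 k2 \<tau> x v \<longleftrightarrow> closed_loop n G k1 k2 \<tau> (state n x v)))
       \<and> (\<forall>\<tau>\<ge>0. \<forall>s. characteristic_fun n G k1 k2 \<tau> s =
            (\<Prod>l\<in>spectrum (laplacian n G).
               char_factor k1 k2 l \<tau> s ^ order l (char_poly (laplacian n G))))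
       \<and> (\<forall>l \<tau> s. char_factor k1 k2 l \<tau> s =
            s\<^sup>2 + complex_of_real l * (complex_of_real k2 * s + complex_of_real k1)
                  * exp (- complex_of_real \<tau> * s))
       \<and> (\<forall>l. most_exigent n G k1 k2 l \<longleftrightarrow> l = Max (spectrum (laplacian n G)))"
  by (intro conjI allI impI follows_protocol_iff_closed_loop[OF assms(4,5)]
      characteristic_fun_eq_prod[OF assms(4,5)] char_factor_eq most_exigent_iff[OF assms])

end
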